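(* Let $G$ be a graph and let $S$ and $T$ be two subsets of $V(G)$. Then \[ S(T(G)) = (S\Delta T)(G), \] where $\Delta$ denotes the symmetric difference of sets.
   Context: All graphs are finite, simple and undirected, with non-empty vertex set. For a graph $G$ and $v\in V(G)$, the Seidel switch $v(G)$ of $G$ by $v$ is the graph on the same vertex set obtained from $G$ by deleting all edges $vy$ with $y\in N_G(v)$ and adding all edges $vz$ with $z\in V(G)\setminus N_G(v)$, $z\neq v$; all other adjacencies are unchanged. Here $N_G(v)$ is the set of neighbors of $v$. For a subset $S=\{v_1,\dots,v_k\}\subseteq V(G)$ (with the $v_i$ distinct), $S(G):=v_k(\cdots v_2(v_1(G)))$, the graph obtained by switching successively at each vertex of $S$; this is independent of the order in which the vertices are used. By convention $\emptyset(G)=G$. The equality is equality of graphs on the same vertex set. *)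

theory Defs
  imports "Graph_Theory.Pair_Digraph"
begin

text \<open>
  A finite simple undirected graph is a \<open>pair_graph\<close>: a finite, loop-free, symmetric relation on
  a finite vertex set, so an edge \<open>xy\<close> is the pair of arcs \<open>(x, y)\<close> and \<open>(y, x)\<close>. Equality of such
  records is equality of vertex sets and of adjacencies. The library allows an empty vertex set.
\<close>

definition nbrs :: "'a pair_pre_digraph \<Rightarrow> 'a \<Rightarrow> 'a set" where
  "nbrs G v = {y \<in> pverts G. v \<rightarrow>\<^bsub>with_proj G\<^esub> y}"

definition seidel_switch :: "'a \<Rightarrow> 'a pair_pre_digraph \<Rightarrow> 'a pair_pre_digraph" where
  "seidel_switch v G =
    \<lparr> pverts = pverts G,
      parcs = (parcs G - (\<Union>y \<in> nbrs G v. {(v, y), (y, v)}))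
        \<union> (\<Union>z \<in> pverts G - nbrs G v - {v}. {(v, z), (z, v)}) \<rparr>"

text \<open>
  \<open>Finite_Set.fold\<close> is determined only when the order of the elements is irrelevant; this is shown
  for subsets of the vertex set in \<open>seidel_switch_set_eq_fold\<close> below.
\<close>

definition seidel_switch_set :: "'a set \<Rightarrow> 'a pair_pre_digraph \<Rightarrow> 'a pair_pre_digraph" where
  "seidel_switch_set S G = Finite_Set.fold seidel_switch G S"

lemma pverts_seidel_switch [simp]: "pverts (seidel_switch v G) = pverts G"
  by (simp add: seidel_switch_def)

lemma pair_graph_seidel_switch:
  assumes "pair_graph G" "v \<in> pverts G"
  shows "pair_graph (seidel_switch v G)"
proof -
  interpret pair_graph G by fact
  have sym: "(x, y) \<in> parcs G \<Longrightarrow> (y, x) \<in> parcs G" for x y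
    using pair_sym_arcs by (auto simp: symmetric_def elim: symE)
  have sub: "parcs (seidel_switch v G) \<subseteq> pverts G \<times> pverts G"
    using assms(2) arc_fst_in_verts arc_snd_in_verts
    by (fastforce simp: seidel_switch_def nbrs_def)
  show ?thesis
  proof unfold_locales
    show "finite (parcs (seidel_switch v G))"
      using sub pair_finite_verts by (meson finite_SigmaI finite_subset)
    show "symmetric (with_proj (seidel_switch v G))"
      using sym by (auto simp: symmetric_def seidel_switch_def nbrs_def intro!: symI)
  qed (use sub pair_finite_verts pair_no_loops in
       \<open>auto simp: seidel_switch_def nbrs_def\<close>)
qed

lemma parcs_seidel_switch_iff:
  assumes "pair_graph G" "v \<in> pverts G"
  shows "(x, y) \<in> parcs (seidel_switch v G) \<longleftrightarrow>
    x \<in> pverts G \<and> y \<in> pverts G \<and> x \<noteq> y \<and> ((x, y) \<in> parcs G \<longleftrightarrow> x \<noteq> v \<and> y \<noteq> v)"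
proof -
  interpret pair_graph G by fact
  have sym: "(v, z) \<in> parcs G \<longleftrightarrow> (z, v) \<in> parcs G" for z
    using pair_sym_arcs by (auto simp: symmetric_def elim: symE)
  have "(a, b) \<in> parcs G \<Longrightarrow> a \<in> pverts G \<and> b \<in> pverts G \<and> a \<noteq> b" for a b
    using arc_fst_in_verts arc_snd_in_verts pair_no_loops by fastforce
  from this[of x y] this[of v x] this[of v y] show ?thesis
    using assms(2) sym[of x] sym[of y] by (auto simp: seidel_switch_def nbrs_def)
qed

lemma seidel_switch_commute:
  assumes "pair_graph G" "v \<in> pverts G" "w \<in> pverts G"
  shows "seidel_switch v (seidel_switch w G) = seidel_switch w (seidel_switch v G)"
proof -
  have "(x, y) \<in> parcs (seidel_switch v (seidel_switch w G)) \<longleftrightarrow>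
      (x, y) \<in> parcs (seidel_switch w (seidel_switch v G))" for x y
    using assms by (simp add: parcs_seidel_switch_iff pair_graph_seidel_switch) blast
  then show ?thesis
    by (intro pair_pre_digraph.equality) auto
qed

lemma pair_graph_fold_seidel_switch:
  assumes "pair_graph G" "set vs \<subseteq> pverts G"
  shows "pair_graph (fold seidel_switch vs G) \<and> pverts (fold seidel_switch vs G) = pverts G"
  using assms by (induction vs arbitrary: G) (auto simp: pair_graph_seidel_switch)

lemma fold_seidel_switch_commute:
  assumes "pair_graph G" "set vs \<subseteq> pverts G" "v \<in> pverts G"
  shows "fold seidel_switch vs (seidel_switch v G) = seidel_switch v (fold seidel_switch vs G)"
  using assms
proof (induction vs arbitrary: G)
  case (Cons a vs)
  then show ?case
    using seidel_switch_commute[of G a v] by (simp add: pair_graph_seidel_switch)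
qed simp

lemma fold_graph_seidel_switch_unique:
  assumes "fold_graph seidel_switch G S H" "pair_graph G" "S \<subseteq> pverts G"
    "distinct vs" "set vs = S"
  shows "H = fold seidel_switch vs G"
  using assms
proof (induction arbitrary: vs rule: fold_graph.induct)
  case emptyI
  then show ?case by simp
next
  case (insertI x A H)
  obtain us ws where vs: "vs = us @ x # ws"
    using insertI.prems by (metis insertI1 split_list)
  have "set (us @ ws) = set vs - {x}" "distinct (us @ ws)"
    using insertI.prems(3) vs by auto
  then have H: "H = fold seidel_switch (us @ ws) G"
    using insertI.hyps insertI.prems by (intro insertI.IH) auto
  have sub: "set us \<subseteq> pverts G" "set ws \<subseteq> pverts G" "x \<in> pverts G"
    using insertI.prems(2,4) unfolding vs by fastforce+
  then have "pair_graph (fold seidel_switch us G)" "pverts (fold seidel_switch us G) = pverts G"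
    using pair_graph_fold_seidel_switch[of G us] insertI.prems(1) by auto
  then have "fold seidel_switch ws (seidel_switch x (fold seidel_switch us G))
      = seidel_switch x (fold seidel_switch ws (fold seidel_switch us G))"
    using sub by (simp add: fold_seidel_switch_commute)
  then show ?case
    using H vs by simp
qed

lemma seidel_switch_set_eq_fold:
  assumes "pair_graph G" "distinct vs" "set vs \<subseteq> pverts G"
  shows "seidel_switch_set (set vs) G = fold seidel_switch vs G"
proof -
  obtain H where H: "fold_graph seidel_switch G (set vs) H"
    using finite_imp_fold_graph[of "set vs"] by (meson List.finite_set)
  then have "(THE H. fold_graph seidel_switch G (set vs) H) = fold seidel_switch vs G"
    using assms fold_graph_seidel_switch_unique by (metis (no_types, lifting) the_equality)
  then show ?thesis
    by (simp add: seidel_switch_set_def Finite_Set.fold_def)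
qed

end

theory Submission
  imports Defs
begin

text \<open>
  Switching at a vertex \<open>v\<close> toggles exactly the pairs of distinct vertices with one end at \<open>v\<close>.
  Hence switching at all vertices of \<open>S\<close> toggles the pair \<open>xy\<close> once for each end in \<open>S\<close>; two toggles
  cancel, so the pair changes if and only if exactly one of \<open>x\<close>, \<open>y\<close> lies in \<open>S\<close>, that is, if it
  crosses the cut \<open>(S, V - S)\<close> (lemma \<open>parcs_seidel_switch_set_iff\<close>). Switching at \<open>T\<close> and then at
  \<open>S\<close> therefore changes the pairs that cross exactly one of the two cuts. Cuts add modulo 2:
  membership in the symmetric difference is the exclusive or of the two memberships, so these are
  the pairs that cross the cut of \<open>(S - T) \<union> (T - S)\<close>.
\<close>

lemma pair_graph_seidel_switch_set:
  assumes "pair_graph G" "S \<subseteq> pverts G"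
  shows "pair_graph (seidel_switch_set S G)" "pverts (seidel_switch_set S G) = pverts G"
proof -
  interpret pair_graph G by fact
  have "finite S"
    using assms(2) pair_finite_verts finite_subset by blast
  then obtain vs where "set vs = S" "distinct vs"
    using finite_distinct_list by blast
  then show "pair_graph (seidel_switch_set S G)" "pverts (seidel_switch_set S G) = pverts G"
    using assms seidel_switch_set_eq_fold pair_graph_fold_seidel_switch by metis+
qed

lemma parcs_pair_graphD:
  assumes "pair_graph G" "(x, y) \<in> parcs G"
  shows "x \<in> pverts G" "y \<in> pverts G" "x \<noteq> y"
proof -
  interpret pair_graph G by fact
  show "x \<in> pverts G" "y \<in> pverts G" "x \<noteq> y"
    using assms(2) arc_fst_in_verts arc_snd_in_verts pair_no_loops by fastforce+
qed

text \<open>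
  The right-hand side is the parity of the number of toggles: for \<open>x \<noteq> y\<close>, the condition
  \<open>x \<noteq> v \<and> y \<noteq> v\<close> for a single switch is \<open>x = v \<longleftrightarrow> y = v\<close>, and \<open>\<longleftrightarrow>\<close> composes over the
  vertices of the list. Distinctness matters, since membership in \<open>set vs\<close> records whether a vertex
  occurs but not the parity of its number of occurrences.
\<close>

lemma parcs_fold_seidel_switch_iff:
  assumes "pair_graph G" "distinct vs" "set vs \<subseteq> pverts G"
  shows "(x, y) \<in> parcs (fold seidel_switch vs G) \<longleftrightarrow>
    x \<in> pverts G \<and> y \<in> pverts G \<and> x \<noteq> y \<and>
    ((x, y) \<in> parcs G \<longleftrightarrow> (x \<in> set vs \<longleftrightarrow> y \<in> set vs))"
  using assms
proof (induction vs arbitrary: G)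
  case Nil
  then show ?case
    by (auto dest: parcs_pair_graphD)
next
  case (Cons v vs)
  have "(x, y) \<in> parcs (fold seidel_switch vs (seidel_switch v G)) \<longleftrightarrow>
      x \<in> pverts G \<and> y \<in> pverts G \<and> x \<noteq> y \<and>
      ((x, y) \<in> parcs (seidel_switch v G) \<longleftrightarrow> (x \<in> set vs \<longleftrightarrow> y \<in> set vs))"
    using Cons.IH[of "seidel_switch v G"] Cons.prems by (simp add: pair_graph_seidel_switch)
  then show ?case
    using Cons.prems by (auto simp: parcs_seidel_switch_iff)
qed

lemma parcs_seidel_switch_set_iff:
  assumes "pair_graph G" "S \<subseteq> pverts G"
  shows "(x, y) \<in> parcs (seidel_switch_set S G) \<longleftrightarrow>
    x \<in> pverts G \<and> y \<in> pverts G \<and> x \<noteq> y \<and> ((x, y) \<in> parcs G \<longleftrightarrow> (x \<in> S \<longleftrightarrow> y \<in> S))"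
proof -
  interpret pair_graph G by fact
  have "finite S"
    using assms(2) pair_finite_verts finite_subset by blast
  then obtain vs where "set vs = S" "distinct vs"
    using finite_distinct_list by blast
  then show ?thesis
    using assms seidel_switch_set_eq_fold[of G vs] parcs_fold_seidel_switch_iff[of G vs x y]
    by simp
qed

theorem theorem2p8:
  fixes G :: "'a pair_pre_digraph" and S T :: "'a set"
  assumes "pair_graph G" and "pverts G \<noteq> {}"
    and "S \<subseteq> pverts G" and "T \<subseteq> pverts G"
  shows "seidel_switch_set S (seidel_switch_set T G) = seidel_switch_set ((S - T) \<union> (T - S)) G"
proof -
  have sub: "(S - T) \<union> (T - S) \<subseteq> pverts G"
    using assms(3,4) by blast
  note switch_T = pair_graph_seidel_switch_set[OF assms(1,4)]
  have "(x, y) \<in> parcs (seidel_switch_set S (seidel_switch_set T G)) \<longleftrightarrow>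
      (x, y) \<in> parcs (seidel_switch_set ((S - T) \<union> (T - S)) G)" for x y
    using assms(3) switch_T
    by (simp add: parcs_seidel_switch_set_iff[OF assms(1) sub]
        parcs_seidel_switch_set_iff[OF assms(1,4)] parcs_seidel_switch_set_iff) blast
  moreover have "pverts (seidel_switch_set S (seidel_switch_set T G)) =
      pverts (seidel_switch_set ((S - T) \<union> (T - S)) G)"
    using assms(1,3) sub switch_T by (simp add: pair_graph_seidel_switch_set(2))
  ultimately show ?thesis
    by (intro pair_pre_digraph.equality) auto
qed

end
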